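(* Let $\mathcal{F}$ be a class of graphs for which there are positive integer constants $r$ and $d$ such that every graph in $\mathcal{F}$ admits both an acyclic coloring with $r$ colors and a $d$-orientation. Then for every integer $k \geq 2$, $$\lambda_{\mathcal{F}}(k) \leq 8dr^4 \binom{8dr^4}{d} k^{d}.$$ In particular, $\lambda_{\mathcal{F}}(k) = O\left(k^{\lceil D(\mathcal{F})\rceil}\right)$ as a function of $k$ (with the implied constant allowed to depend on $\mathcal{F}$).
   Context: All graphs are finite, have at least one vertex, and have no loops or multiple edges. A class of graphs is a nonempty set of graphs. For $k\in\mathbb{N}$, $[k]=\{1,\ldots,k\}$. A $k$-edge-colored graph is a pair $(G,c)$ where $G$ is a graph (the underlying graph) and $c:E(G)\to[k]$ is an arbitrary mapping (not required to be a proper edge coloring). A homomorphism of a $k$-edge-colored graph $(G_1,c_1)$ to a $k$-edge-colored graph $(G_2,c_2)$ is a mapping $h:V(G_1)\to V(G_2)$ such that for every two vertices $u,v$ adjacent in $G_1$, $h(u)$ and $h(v)$ are adjacent in $G_2$ and $c_1(\{u,v\})=c_2(\{h(u),h(v)\})$. A $k$-edge-colored graph $\mathbb{H}$ (finite, with underlying graph not necessarily in $\mathcal{F}$) is $k$-universal for $\mathcal{F}$ if every $k$-edge-colored graph whose underlying graph is in $\mathcal{F}$ admits a homomorphism to $\mathbb{H}$. $\lambda_{\mathcal{F}}(k)$ is the minimum number of vertices in a $k$-universal graph for $\mathcal{F}$, and $\lambda_{\mathcal{F}}(k)=\infty$ if no such graph exists. An acyclic coloring of a graph is an assignment of colors to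 its vertices such that adjacent vertices get different colors and the vertices of any cycle get at least $3$ different colors; a coloring "with $r$ colors" is one using colors from a set of size $r$. An orientation $\vec{G}$ of $G$ assigns a direction to each edge of $G$; the in-degree of a vertex $b$ is the number of edges directed towards $b$. A $d$-orientation is an orientation in which every vertex has in-degree at most $d$. The density of a graph $G$ is $D(G)=\max\{|E(G')|/|V(G')| : G' \text{ is a nonempty subgraph of } G\}$, where nonempty means having at least one vertex, and the density of a class is $D(\mathcal{F})=\sup\{D(G): G\in\mathcal{F}\}$. Notation: $f(k)=O(g(k))$ means that there exist constants $n_0,c$ with $|f(k)|\le c|g(k)|$ for all $k\ge n_0$. *)

theory Defs
  imports "HOL-Library.Extended_Real"
begin

section \<open>Finite simple graphs\<close>

record 'a ugraph =
  verts :: "'a set"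
  edges :: "'a set set"

definition simple_graph :: "'a ugraph \<Rightarrow> bool" where
  "simple_graph G \<longleftrightarrow>
     finite (verts G) \<and> verts G \<noteq> {} \<and> (\<forall>e\<in>edges G. e \<subseteq> verts G \<and> card e = 2)"

definition graph_class :: "'a ugraph set \<Rightarrow> bool" where
  "graph_class F \<longleftrightarrow> F \<noteq> {} \<and> (\<forall>G\<in>F. simple_graph G)"

text \<open>Since \<open>simple_graph\<close> requires a vertex, all subgraphs here are nonempty.\<close>

definition subgraph :: "'a ugraph \<Rightarrow> 'a ugraph \<Rightarrow> bool" where
  "subgraph H G \<longleftrightarrow> simple_graph H \<and> verts H \<subseteq> verts G \<and> edges H \<subseteq> edges G"


section \<open>Edge-colored graphs and universal graphs\<close>

definition edge_colored_graph :: "nat \<Rightarrow> 'a ugraph \<Rightarrow> ('a set \<Rightarrow> nat) \<Rightarrow> bool" where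
  "edge_colored_graph k G c \<longleftrightarrow> simple_graph G \<and> c ` edges G \<subseteq> {1..k}"

definition colored_hom ::
    "'a ugraph \<Rightarrow> ('a set \<Rightarrow> nat) \<Rightarrow> 'b ugraph \<Rightarrow> ('b set \<Rightarrow> nat) \<Rightarrow> ('a \<Rightarrow> 'b) \<Rightarrow> bool" where
  "colored_hom G1 c1 G2 c2 h \<longleftrightarrow>
     h ` verts G1 \<subseteq> verts G2 \<and>
     (\<forall>u v. {u, v} \<in> edges G1 \<longrightarrow>
        {h u, h v} \<in> edges G2 \<and> c1 {u, v} = c2 {h u, h v})"

definition universal_graph ::
    "nat \<Rightarrow> 'a ugraph set \<Rightarrow> 'b ugraph \<Rightarrow> ('b set \<Rightarrow> nat) \<Rightarrow> bool" where
  "universal_graph k F H cH \<longleftrightarrow>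
     edge_colored_graph k H cH \<and>
     (\<forall>G\<in>F. \<forall>c. edge_colored_graph k G c \<longrightarrow> (\<exists>h. colored_hom G c H cH h))"

text \<open>Universal graphs are finite, so it is no restriction to take their vertices in
  \<open>nat\<close>. The infimum is a minimum if a universal graph exists, and \<open>Inf {} = \<infinity>\<close>
  in \<open>enat\<close> otherwise.\<close>

definition universal_number :: "'a ugraph set \<Rightarrow> nat \<Rightarrow> enat" where
  "universal_number F k =
     Inf {enat (card (verts H)) | (H :: nat ugraph) cH. universal_graph k F H cH}"


section \<open>Acyclic colorings\<close>

text \<open>A cycle is given by the list of its vertices in cyclic order.\<close>

definition cycle :: "'a ugraph \<Rightarrow> 'a list \<Rightarrow> bool" where
  "cycle G vs \<longleftrightarrow>
     3 \<le> length vs \<and> distinct vs \<and> set vs \<subseteq> verts G \<and>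
     (\<forall>i<length vs. {vs ! i, vs ! (Suc i mod length vs)} \<in> edges G)"

definition acyclic_coloring :: "nat \<Rightarrow> 'a ugraph \<Rightarrow> ('a \<Rightarrow> nat) \<Rightarrow> bool" where
  "acyclic_coloring r G f \<longleftrightarrow>
     f ` verts G \<subseteq> {1..r} \<and>
     (\<forall>u v. {u, v} \<in> edges G \<longrightarrow> f u \<noteq> f v) \<and>
     (\<forall>vs. cycle G vs \<longrightarrow> 3 \<le> card (f ` set vs))"


section \<open>Orientations\<close>

text \<open>The arc \<open>(a, b)\<close> is directed from \<open>a\<close> towards \<open>b\<close>; the bijection says that every
  edge receives exactly one of its two directions.\<close>

definition orientation :: "'a ugraph \<Rightarrow> ('a \<times> 'a) set \<Rightarrow> bool" where
  "orientation G A \<longleftrightarrow> bij_betw (\<lambda>(a, b). {a, b}) A (edges G)"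

definition indegree :: "('a \<times> 'a) set \<Rightarrow> 'a \<Rightarrow> nat" where
  "indegree A b = card {a. (a, b) \<in> A}"

definition bounded_orientation :: "nat \<Rightarrow> 'a ugraph \<Rightarrow> ('a \<times> 'a) set \<Rightarrow> bool" where
  "bounded_orientation d G A \<longleftrightarrow> orientation G A \<and> (\<forall>b\<in>verts G. indegree A b \<le> d)"


section \<open>Density\<close>

definition density :: "'a ugraph \<Rightarrow> real" where
  "density G = Max {real (card (edges H)) / real (card (verts H)) | H. subgraph H G}"

definition class_density :: "'a ugraph set \<Rightarrow> ereal" where
  "class_density F = (SUP G\<in>F. ereal (density G))"

end

theory Submission
  imports Defs "HOL-Library.FuncSet"
begin

text \<open>
  A graph \<open>G\<close> with a \<open>d\<close>-orientation can be encoded locally: give each vertex a label, and let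
  each vertex record the labels of its in-neighbours together with the colors of the arcs coming
  from them. If the in-neighbours of a vertex have distinct labels, the color of an arc can be read
  off from what its head records; if no vertex has the label of one of the in-neighbours of its
  in-neighbours, the direction of an edge can be read off as well. With \<open>N\<close> labels there are
  \<open>N * (N choose d) * k ^ d\<close> possible encodings, once the records are padded to exactly \<open>d\<close>
  labels, and these encodings are the vertices of a universal graph.

  What remains is to find such labels with \<open>N\<close> bounded in terms of \<open>d\<close> and \<open>r\<close>. The ends \<open>w\<close> and
  \<open>v\<close> of every path \<open>w \<rightarrow> u \<rightarrow> v\<close> or \<open>w \<rightarrow> u \<leftarrow> v\<close> have to be told apart. An acyclic coloring \<open>f\<close>
  does this unless \<open>f w = f v\<close>. In that case, the path lies in the forest spanned by the two color
  classes of \<open>w\<close> and \<open>u\<close>. In a set \<open>W\<close> of vertices of one color, a middle vertex \<open>u\<close> with \<open>n\<close>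
  neighbours in \<open>W\<close> causes at most \<open>d * (n - 1)\<close> such conflicts, and since a forest has at most as
  many edges as vertices, the numbers \<open>n - 1\<close> sum to at most \<open>card W\<close> over each color class. Hence
  some vertex of \<open>W\<close> has at most \<open>2 * d * r\<close> conflicts in \<open>W\<close> (\<open>conflict_degenerate\<close>), and a greedy
  coloring of the conflicts, paired with \<open>f\<close>, uses \<open>r * (2 * d * r + 1)\<close> labels
  (\<open>separating_coloring_exists\<close>). Adding \<open>d\<close> labels for padding stays below \<open>8 * d * r ^ 4\<close>.

  For the asymptotic bound, the number \<open>d\<close> is replaced by the density rounded up: a graph in which
  every vertex set \<open>X\<close> spans at most \<open>m * card X\<close> edges has an \<open>m\<close>-orientation
  (\<open>bounded_orientation_if_sparse\<close>, a theorem of Hakimi). The density of the class is finite because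
  conversely a \<open>d\<close>-orientation bounds the density of a graph by \<open>d\<close>.
\<close>

section \<open>Orientations as sets of arcs\<close>

lemma orientation_iff:
  assumes "simple_graph G"
  shows "orientation G A \<longleftrightarrow>
    (\<forall>a b. (a, b) \<in> A \<longrightarrow> {a, b} \<in> edges G \<and> (b, a) \<notin> A) \<and>
    (\<forall>a b. {a, b} \<in> edges G \<longrightarrow> (a, b) \<in> A \<or> (b, a) \<in> A)"
    (is "_ \<longleftrightarrow> ?arcs \<and> ?cover")
proof
  assume "orientation G A"
  then have inj: "inj_on (\<lambda>(a, b). {a, b}) A" and img: "(\<lambda>(a, b). {a, b}) ` A = edges G"
    by (auto simp: orientation_def bij_betw_def)
  have edge: "{a, b} \<in> edges G" if "(a, b) \<in> A" for a b
    using that img by force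
  have ?arcs
  proof (intro allI impI conjI)
    fix a b assume ab: "(a, b) \<in> A"
    show "{a, b} \<in> edges G" using edge[OF ab] .
    then have "a \<noteq> b" using assms by (force simp: simple_graph_def)
    then show "(b, a) \<notin> A" using inj_onD[OF inj, of "(a, b)" "(b, a)"] ab by auto
  qed
  moreover have ?cover
  proof (intro allI impI)
    fix a b assume "{a, b} \<in> edges G"
    then have "{a, b} \<in> (\<lambda>(a, b). {a, b}) ` A" using img by simp
    then obtain a' b' where "(a', b') \<in> A" "{a, b} = {a', b'}" by auto
    then show "(a, b) \<in> A \<or> (b, a) \<in> A" by (auto simp: doubleton_eq_iff)
  qed
  ultimately show "?arcs \<and> ?cover" ..
next
  assume R: "?arcs \<and> ?cover"
  show "orientation G A"
    unfolding orientation_def bij_betw_def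
  proof
    show "inj_on (\<lambda>(a, b). {a, b}) A"
      using R by (auto simp: inj_on_def doubleton_eq_iff)
    show "(\<lambda>(a, b). {a, b}) ` A = edges G"
    proof
      show "(\<lambda>(a, b). {a, b}) ` A \<subseteq> edges G" using R by auto
      show "edges G \<subseteq> (\<lambda>(a, b). {a, b}) ` A"
      proof
        fix e assume e: "e \<in> edges G"
        then have "card e = 2" using assms by (auto simp: simple_graph_def)
        then obtain a b where "e = {a, b}" by (auto simp: card_2_iff)
        with e R have "(a, b) \<in> A \<or> (b, a) \<in> A" by blast
        with \<open>e = {a, b}\<close> show "e \<in> (\<lambda>(a, b). {a, b}) ` A" by (auto intro: rev_image_eqI)
      qed
    qed
  qed
qed

lemma edge_endpoints:
  assumes "simple_graph G" "{a, b} \<in> edges G"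
  shows "a \<in> verts G" "b \<in> verts G" "a \<noteq> b"
  using assms by (force simp: simple_graph_def)+

lemma simple_graph_finite_edges:
  assumes "simple_graph G"
  shows "finite (edges G)"
  by (rule finite_subset[of _ "Pow (verts G)"]) (use assms in \<open>auto simp: simple_graph_def\<close>)

lemma orientation_finite:
  assumes "simple_graph G" "orientation G A"
  shows "finite A"
  using assms simple_graph_finite_edges bij_betw_finite unfolding orientation_def by blast

lemma orientation_exists:
  assumes "simple_graph G"
  obtains A where "orientation G A"
proof -
  have "\<forall>e\<in>edges G. \<exists>p. (\<lambda>(a, b). {a, b}) p = e"
  proof
    fix e assume "e \<in> edges G"
    then have "card e = 2" using assms by (auto simp: simple_graph_def)
    then obtain a b where "e = {a, b}" by (auto simp: card_2_iff)
    then show "\<exists>p. (\<lambda>(a, b). {a, b}) p = e" by (intro exI[of _ "(a, b)"]) simp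
  qed
  then obtain h where h: "\<And>e. e \<in> edges G \<Longrightarrow> (\<lambda>(a, b). {a, b}) (h e) = e"
    by metis
  have "orientation G (h ` edges G)"
    unfolding orientation_def bij_betw_def inj_on_def using h by (auto simp: image_image)
  then show thesis ..
qed

lemma finite_in_neighbours:
  assumes "finite A"
  shows "finite {a. (a, b) \<in> A}"
  using finite_imageI[OF assms, of fst] by (rule rev_finite_subset) force

lemma card_arcs_into:
  assumes "finite A" "finite R"
  shows "card {(a, b) \<in> A. b \<in> R} = (\<Sum>b\<in>R. indegree A b)"
proof -
  have "{(a, b) \<in> A. b \<in> R} = (\<lambda>(b, a). (a, b)) ` (SIGMA b:R. {a. (a, b) \<in> A})" by force
  moreover have "inj_on (\<lambda>(b, a). (a, b)) S" for S :: "('a \<times> 'a) set"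
    by (auto simp: inj_on_def)
  ultimately show ?thesis
    using assms(2) finite_in_neighbours[OF assms(1)] by (simp add: card_image indegree_def)
qed

section \<open>Forests\<close>

definition is_path :: "'a set set \<Rightarrow> 'a list \<Rightarrow> bool" where
  "is_path E p \<longleftrightarrow> distinct p \<and> (\<forall>i. Suc i < length p \<longrightarrow> {p ! i, p ! Suc i} \<in> E)"

lemma is_path_Cons:
  assumes "is_path E p" "x \<notin> set p" "p \<noteq> [] \<Longrightarrow> {x, p ! 0} \<in> E"
  shows "is_path E (x # p)"
  unfolding is_path_def
proof (intro conjI allI impI)
  show "distinct (x # p)" using assms by (simp add: is_path_def)
  show "{(x # p) ! i, (x # p) ! Suc i} \<in> E" if "Suc i < length (x # p)" for i
    using that assms by (cases i) (auto simp: is_path_def)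
qed

text \<open>All neighbours of the first vertex of a longest path lie on the path, and each of
  them beyond the second vertex closes a cycle.\<close>
lemma cycle_if_degree_ge_2:
  assumes "finite V" "V \<noteq> {}" and E: "\<And>e. e \<in> E \<Longrightarrow> e \<subseteq> V \<and> card e = 2"
    and deg: "\<And>v. v \<in> V \<Longrightarrow> \<exists>x y. x \<noteq> y \<and> {v, x} \<in> E \<and> {v, y} \<in> E"
  shows "\<exists>vs. cycle \<lparr>verts = V, edges = E\<rparr> vs"
proof -
  let ?P = "\<lambda>p. is_path E p \<and> set p \<subseteq> V"
  obtain v0 where "v0 \<in> V" using assms by blast
  then have "?P [v0]" by (simp add: is_path_def)
  moreover have "length p < Suc (card V)" if "?P p" for p
    using that card_mono[OF \<open>finite V\<close>, of "set p"] by (simp add: is_path_def distinct_card)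
  ultimately obtain p where p: "?P p" and longest: "\<And>q. ?P q \<Longrightarrow> length q \<le> length p"
    using ex_has_greatest_nat[of ?P "[v0]" length "Suc (card V)"] by blast
  have "length p \<ge> 1" using longest[OF \<open>?P [v0]\<close>] by simp
  then have "p ! 0 \<in> set p" by (cases p) auto
  then have p0: "p ! 0 \<in> V" and "p \<noteq> []" using p by auto
  have on_path: "\<exists>i. 1 \<le> i \<and> i < length p \<and> x = p ! i" if x: "{p ! 0, x} \<in> E" for x
  proof -
    have "x \<in> V" and "x \<noteq> p ! 0" using E[OF x] by auto
    have "x \<in> set p"
    proof (rule ccontr)
      assume "x \<notin> set p"
      then have "?P (x # p)" using p x is_path_Cons[of E p x] \<open>x \<in> V\<close> by (simp add: insert_commute)
      then show False using longest by fastforce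
    qed
    then obtain i where "i < length p" "x = p ! i" by (auto simp: in_set_conv_nth)
    with \<open>x \<noteq> p ! 0\<close> show ?thesis by (cases i) auto
  qed
  obtain x y where "x \<noteq> y" "{p ! 0, x} \<in> E" "{p ! 0, y} \<in> E" using deg[OF p0] by blast
  then obtain j where j: "2 \<le> j" "j < length p" and close: "{p ! 0, p ! j} \<in> E"
    using on_path[of x] on_path[of y]
    by (metis One_nat_def Suc_1 le_antisym not_less_eq_eq)
  let ?c = "take (Suc j) p"
  have "cycle \<lparr>verts = V, edges = E\<rparr> ?c"
    unfolding cycle_def
  proof (intro conjI allI impI)
    show "3 \<le> length ?c" "distinct ?c" using j p by (auto simp: is_path_def)
    show "set ?c \<subseteq> verts \<lparr>verts = V, edges = E\<rparr>" using p set_take_subset by fastforce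
    fix i assume "i < length ?c"
    then have "i < j \<or> i = j" using j by auto
    then show "{?c ! i, ?c ! (Suc i mod length ?c)} \<in> edges \<lparr>verts = V, edges = E\<rparr>"
      using p j close by (auto simp: is_path_def insert_commute)
  qed
  then show ?thesis ..
qed

lemma cycle_mono:
  assumes "cycle \<lparr>verts = V, edges = E\<rparr> vs" "V \<subseteq> verts G" "E \<subseteq> edges G"
  shows "cycle G vs"
  using assms by (auto simp: cycle_def)

text \<open>By induction, deleting a vertex of degree at most one.\<close>
lemma forest_card_edges_le:
  assumes "finite V" "\<And>e. e \<in> E \<Longrightarrow> e \<subseteq> V \<and> card e = 2"
    and "\<nexists>vs. cycle \<lparr>verts = V, edges = E\<rparr> vs"
  shows "card E \<le> card V"
  using assms
proof (induction "card V" arbitrary: V E)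
  case 0
  then have "E = {}" by fastforce
  then show ?case by simp
next
  case (Suc n)
  then have "V \<noteq> {}" by auto
  then obtain v where v: "v \<in> V" and
    leaf: "\<And>x y. {v, x} \<in> E \<Longrightarrow> {v, y} \<in> E \<Longrightarrow> x = y"
    using cycle_if_degree_ge_2[of V E] Suc.prems by metis
  let ?E = "{e \<in> E. v \<notin> e}" and ?V = "V - {v}"
  have finE: "finite E" using Suc.prems(1,2) finite_subset[of E "Pow V"] by auto
  have "card ?E \<le> card ?V"
  proof (rule Suc.hyps(1))
    show "n = card ?V" using Suc.hyps(2) v Suc.prems(1) by simp
    show "\<nexists>vs. cycle \<lparr>verts = ?V, edges = ?E\<rparr> vs"
      using Suc.prems(3) cycle_mono[of ?V ?E _ "\<lparr>verts = V, edges = E\<rparr>"] by auto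
  qed (use Suc.prems in auto)
  moreover have "card {e \<in> E. v \<in> e} \<le> 1"
  proof -
    have "e = e'" if "e \<in> E" "v \<in> e" "e' \<in> E" "v \<in> e'" for e e'
    proof -
      have form: "\<exists>x. e = {v, x}" if "e \<in> E" "v \<in> e" for e
      proof -
        have "card e = 2" using Suc.prems(2) that by blast
        then show ?thesis using that by (auto simp: card_2_iff)
      qed
      obtain x y where "e = {v, x}" "e' = {v, y}" using form \<open>e \<in> E\<close> \<open>v \<in> e\<close> \<open>e' \<in> E\<close> \<open>v \<in> e'\<close> by metis
      then show ?thesis using leaf that by blast
    qed
    then show ?thesis using finE by (auto simp: card_le_Suc0_iff_eq)
  qed
  moreover have "card E = card ?E + card {e \<in> E. v \<in> e}"
    using finE by (subst card_Un_disjoint[symmetric]) (auto intro: arg_cong[where f=card])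
  ultimately show ?case using v Suc.prems(1) Suc.hyps(2) by simp
qed

section \<open>Coloring the ends of short directed paths\<close>

text \<open>Taking both directions of the second edge covers the directed paths with two arcs as well as
  the pairs of arcs with the same head. Two arcs with the same tail impose no condition: a vertex
  may have any number of out-neighbours, so a bounded number of labels cannot separate them.\<close>
definition separates_paths :: "('a \<times> 'a) set \<Rightarrow> ('a \<Rightarrow> nat) \<Rightarrow> bool" where
  "separates_paths A g \<longleftrightarrow>
     (\<forall>w u v. w \<noteq> v \<longrightarrow> (w, u) \<in> A \<longrightarrow> (v, u) \<in> A \<or> (u, v) \<in> A \<longrightarrow> g w \<noteq> g v)"

text \<open>Greedy coloring: a vertex with at most \<open>m\<close> \<open>R\<close>-neighbours is colored last.\<close>
lemma degenerate_coloring: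
  assumes "finite V" and sym: "\<And>x y. R x y \<Longrightarrow> R y x"
    and "\<And>W. W \<subseteq> V \<Longrightarrow> W \<noteq> {} \<Longrightarrow> \<exists>w\<in>W. card {v \<in> W. R w v} \<le> m"
  shows "\<exists>g::'a \<Rightarrow> nat. g ` V \<subseteq> {..m} \<and> (\<forall>x\<in>V. \<forall>y\<in>V. x \<noteq> y \<longrightarrow> R x y \<longrightarrow> g x \<noteq> g y)"
  using assms(1,3)
proof (induction "card V" arbitrary: V)
  case 0
  then show ?case by auto
next
  case (Suc n)
  then have "V \<noteq> {}" by auto
  then obtain w where w: "w \<in> V" "card {v \<in> V. R w v} \<le> m" using Suc.prems by blast
  have n: "n = card (V - {w})" using Suc.hyps(2) w Suc.prems(1) by simp
  have fin: "finite (V - {w})" using Suc.prems(1) by simp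
  have sub: "\<exists>w\<in>W. card {v \<in> W. R w v} \<le> m" if "W \<subseteq> V - {w}" "W \<noteq> {}" for W
    by (rule Suc.prems(2)) (use that in auto)
  have "\<exists>g::'a \<Rightarrow> nat. g ` (V - {w}) \<subseteq> {..m} \<and>
      (\<forall>x\<in>V - {w}. \<forall>y\<in>V - {w}. x \<noteq> y \<longrightarrow> R x y \<longrightarrow> g x \<noteq> g y)"
    by (rule Suc.hyps(1)[OF n fin]) (rule sub)
  then obtain g :: "'a \<Rightarrow> nat" where "g ` (V - {w}) \<subseteq> {..m} \<and>
      (\<forall>x\<in>V - {w}. \<forall>y\<in>V - {w}. x \<noteq> y \<longrightarrow> R x y \<longrightarrow> g x \<noteq> g y)"
    by (rule exE)
  then have g: "g ` (V - {w}) \<subseteq> {..m}"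
    "\<And>x y. x \<in> V - {w} \<Longrightarrow> y \<in> V - {w} \<Longrightarrow> x \<noteq> y \<Longrightarrow> R x y \<Longrightarrow> g x \<noteq> g y"
    by simp_all
  have "card (g ` {v \<in> V. R w v}) \<le> m"
    using card_image_le[of "{v \<in> V. R w v}" g] w(2) Suc.prems(1) by simp
  then have "\<not> {..m} \<subseteq> g ` {v \<in> V. R w v}"
    using card_mono[of "g ` {v \<in> V. R w v}" "{..m}"] Suc.prems(1) by auto
  then obtain c where c: "c \<le> m" "c \<notin> g ` {v \<in> V. R w v}" by auto
  have "(g(w := c)) ` V \<subseteq> {..m}" using g(1) c(1) by auto
  moreover have "(g(w := c)) x \<noteq> (g(w := c)) y" if "x \<in> V" "y \<in> V" "x \<noteq> y" "R x y" for x y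
    using that g(2)[of x y] c(2) sym by (cases "x = w"; cases "y = w") auto
  ultimately show ?case by blast
qed

text \<open>A cycle needs three colors, so the edges inside two color classes form a forest.\<close>
lemma card_two_colored_edges_le:
  assumes "simple_graph G" "acyclic_coloring r G f"
    and "S \<subseteq> verts G" "f ` S \<subseteq> {i, j}"
  shows "card {e \<in> edges G. e \<subseteq> S} \<le> card S"
proof (rule forest_card_edges_le)
  show "finite S" using assms by (auto simp: simple_graph_def intro: finite_subset)
  show "e \<subseteq> S \<and> card e = 2" if "e \<in> {e \<in> edges G. e \<subseteq> S}" for e
    using that assms by (auto simp: simple_graph_def)
  show "\<nexists>vs. cycle \<lparr>verts = S, edges = {e \<in> edges G. e \<subseteq> S}\<rparr> vs"
  proof
    assume "\<exists>vs. cycle \<lparr>verts = S, edges = {e \<in> edges G. e \<subseteq> S}\<rparr> vs"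
    then obtain vs where vs: "cycle \<lparr>verts = S, edges = {e \<in> edges G. e \<subseteq> S}\<rparr> vs" ..
    then have "cycle G vs" by (rule cycle_mono) (use assms(3) in auto)
    then have "3 \<le> card (f ` set vs)" using assms(2) by (simp add: acyclic_coloring_def)
    also have "\<dots> \<le> card {i, j}"
      using vs assms(4) by (intro card_mono) (auto simp: cycle_def)
    also have "\<dots> \<le> 2" by (simp add: card_insert_if)
    finally show False by simp
  qed
qed

text \<open>Let \<open>U\<close> be the set of vertices of color \<open>j\<close> with a neighbour in \<open>W\<close>. The degrees \<open>card (N u)\<close>
  count edges of a forest on \<open>W \<union> U\<close>, so they sum to at most \<open>card W + card U\<close>; lowering each of them
  by one removes \<open>card U\<close>. The remaining vertices contribute \<open>0 - 1 = 0\<close> in \<open>nat\<close>.\<close>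
lemma sum_excess_degree_color_class_le:
  assumes G: "simple_graph G" and f: "acyclic_coloring r G f"
    and W: "W \<subseteq> verts G" "\<And>w. w \<in> W \<Longrightarrow> f w = i"
  defines "N \<equiv> \<lambda>u. {w \<in> W. {w, u} \<in> edges G}"
  shows "(\<Sum>u | u \<in> verts G \<and> f u = j. card (N u) - 1) \<le> card W"
proof -
  define U where "U = {u \<in> verts G. f u = j \<and> N u \<noteq> {}}"
  have finV: "finite (verts G)" using G by (simp add: simple_graph_def)
  have finW: "finite W" and finU: "finite U"
    using W(1) finV by (auto simp: U_def intro: finite_subset)
  have finN: "finite (N u)" for u using finW by (simp add: N_def)
  have nbr: "f w = i \<and> f u = j \<and> i \<noteq> j" if "u \<in> U" "w \<in> N u" for u w
    using that W(2) f by (auto simp: U_def N_def acyclic_coloring_def)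
  have "(\<Sum>u\<in>U. card (N u)) = card (SIGMA u:U. N u)"
    using finU finN by simp
  also have "\<dots> \<le> card {e \<in> edges G. e \<subseteq> W \<union> U}"
  proof (rule card_inj_on_le)
    show "inj_on (\<lambda>(u, w). {w, u}) (SIGMA u:U. N u)"
    proof (rule inj_onI, clarify)
      fix u w u' w' assume "u \<in> U" "w \<in> N u" "u' \<in> U" "w' \<in> N u'" and eq: "{w, u} = {w', u'}"
      then have "f w = i" "f u = j" "f w' = i" "f u' = j" "i \<noteq> j" using nbr by blast+
      then have "w \<noteq> u'" by blast
      then show "u = u' \<and> w = w'" using eq by (simp add: doubleton_eq_iff)
    qed
    show "(\<lambda>(u, w). {w, u}) ` (SIGMA u:U. N u) \<subseteq> {e \<in> edges G. e \<subseteq> W \<union> U}"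
      by (auto simp: N_def)
    show "finite {e \<in> edges G. e \<subseteq> W \<union> U}" using simple_graph_finite_edges[OF G] by simp
  qed
  also have "\<dots> \<le> card (W \<union> U)"
    by (rule card_two_colored_edges_le[OF G f, where i = i and j = j])
      (use W in \<open>auto simp: U_def\<close>)
  also have "\<dots> \<le> card W + card U" by (rule card_Un_le)
  finally have deg: "(\<Sum>u\<in>U. card (N u)) \<le> card W + card U" .
  have "(\<Sum>u\<in>U. card (N u) - 1) + card U = (\<Sum>u\<in>U. card (N u) - 1 + 1)"
    by (simp only: sum.distrib card_eq_sum)
  also have "\<dots> = (\<Sum>u\<in>U. card (N u))"
    using finN by (intro sum.cong) (auto simp: U_def Suc_leI card_gt_0_iff)
  finally have "(\<Sum>u\<in>U. card (N u) - 1) \<le> card W" using deg by simp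
  moreover have "(\<Sum>u | u \<in> verts G \<and> f u = j. card (N u) - 1) = (\<Sum>u\<in>U. card (N u) - 1)"
    by (rule sum.mono_neutral_right) (use finV in \<open>auto simp: U_def\<close>)
  ultimately show ?thesis by simp
qed

lemma sum_excess_degree_le:
  assumes G: "simple_graph G" and f: "acyclic_coloring r G f"
    and W: "W \<subseteq> verts G" "\<And>w. w \<in> W \<Longrightarrow> f w = i"
  shows "(\<Sum>u\<in>verts G. card {w \<in> W. {w, u} \<in> edges G} - 1) \<le> r * card W"
proof -
  let ?h = "\<lambda>u. card {w \<in> W. {w, u} \<in> edges G} - 1"
  have "sum ?h (verts G) = (\<Sum>j\<in>{1..r}. sum ?h {u \<in> verts G. f u = j})"
    by (rule sum.group[symmetric])
      (use G f in \<open>auto simp: simple_graph_def acyclic_coloring_def\<close>)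
  also have "\<dots> \<le> (\<Sum>j\<in>{1..r}. card W)"
    by (rule sum_mono) (rule sum_excess_degree_color_class_le[OF G f W])
  finally show ?thesis by simp
qed

text \<open>The pairs that a separating coloring has to distinguish and \<open>f\<close> does not. The condition is
  symmetric in \<open>w\<close> and \<open>v\<close>: at least one of the two edges is directed towards the middle vertex.\<close>
definition conflict :: "'a ugraph \<Rightarrow> ('a \<times> 'a) set \<Rightarrow> ('a \<Rightarrow> nat) \<Rightarrow> 'a \<Rightarrow> 'a \<Rightarrow> bool" where
  "conflict G A f w v \<longleftrightarrow> w \<noteq> v \<and> f w = f v \<and>
     (\<exists>u. {w, u} \<in> edges G \<and> {v, u} \<in> edges G \<and> ((w, u) \<in> A \<or> (v, u) \<in> A))"

text \<open>Conflicts join vertices of equal color only, so it suffices to treat a color class \<open>X\<close> of \<open>W\<close>.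
  A conflict through \<open>u\<close> consists of an in-neighbour of \<open>u\<close>, at most \<open>d\<close> choices, and another
  neighbour of \<open>u\<close> in \<open>X\<close>. This product is linear in the degree of \<open>u\<close> minus one, which is why
  \<open>sum_excess_degree_le\<close> bounds the average number of conflicts in \<open>X\<close>.\<close>
lemma conflict_degenerate:
  assumes G: "simple_graph G" and f: "acyclic_coloring r G f" and A: "bounded_orientation d G A"
    and W: "W \<subseteq> verts G" "W \<noteq> {}"
  shows "\<exists>w\<in>W. card {v \<in> W. conflict G A f w v} \<le> 2 * d * r"
proof -
  obtain w0 where "w0 \<in> W" using W(2) by blast
  define X where "X = {w \<in> W. f w = f w0}"
  have X: "X \<subseteq> verts G" "X \<noteq> {}" and color: "\<And>w. w \<in> X \<Longrightarrow> f w = f w0"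
    using W(1) \<open>w0 \<in> W\<close> by (auto simp: X_def)
  have finV: "finite (verts G)" using G by (simp add: simple_graph_def)
  then have finX: "finite X" using X(1) finite_subset by blast
  have ori: "orientation G A" and indeg: "\<And>b. b \<in> verts G \<Longrightarrow> indegree A b \<le> d"
    using A by (auto simp: bounded_orientation_def)
  note A_iff = orientation_iff[OF G, THEN iffD1, OF ori]
  note finA = finite_in_neighbours[OF orientation_finite[OF G ori]]
  define N where "N u = {w \<in> X. {w, u} \<in> edges G}" for u
  define Q where "Q u = (SIGMA w:{w \<in> X. (w, u) \<in> A}. N u - {w})" for u
  have finN: "finite (N u)" for u using finX by (simp add: N_def)
  have card_Q: "card (Q u) \<le> d * (card (N u) - 1)" if "u \<in> verts G" for u
  proof -
    have "card (Q u) = (\<Sum>w | w \<in> X \<and> (w, u) \<in> A. card (N u - {w}))"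
      unfolding Q_def using finX finN by simp
    also have "\<dots> = (\<Sum>w | w \<in> X \<and> (w, u) \<in> A. card (N u) - 1)"
      using A_iff by (intro sum.cong) (auto simp: N_def)
    also have "\<dots> = card {w \<in> X. (w, u) \<in> A} * (card (N u) - 1)" by simp
    also have "card {w \<in> X. (w, u) \<in> A} \<le> indegree A u"
      unfolding indegree_def by (rule card_mono) (use finA in auto)
    also have "\<dots> \<le> d" using indeg[OF that] .
    finally show ?thesis by simp
  qed
  have finQ: "finite (Q u)" for u using finX finN by (simp add: Q_def)
  let ?conf = "SIGMA w:X. {v \<in> X. conflict G A f w v}"
  have "?conf \<subseteq> (\<Union>u\<in>verts G. Q u \<union> prod.swap ` Q u)"
  proof
    fix p assume "p \<in> ?conf"
    then obtain w v u where p: "p = (w, v)" "w \<in> X" "v \<in> X" "w \<noteq> v"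
      and u: "{w, u} \<in> edges G" "{v, u} \<in> edges G" "(w, u) \<in> A \<or> (v, u) \<in> A"
      by (auto simp: conflict_def)
    \<comment> \<open>\<open>Q u\<close> lists the pairs whose first component is an in-neighbour of \<open>u\<close>.\<close>
    have "(w, v) \<in> Q u \<or> (v, w) \<in> Q u" using p u by (auto simp: Q_def N_def)
    then have "p \<in> Q u \<union> prod.swap ` Q u" using p(1) by force
    moreover have "u \<in> verts G" using edge_endpoints(2)[OF G u(1)] .
    ultimately show "p \<in> (\<Union>u\<in>verts G. Q u \<union> prod.swap ` Q u)" by blast
  qed
  then have "card ?conf \<le> card (\<Union>u\<in>verts G. Q u \<union> prod.swap ` Q u)"
    by (rule card_mono[rotated]) (use finV finQ in auto)
  also have "\<dots> \<le> (\<Sum>u\<in>verts G. card (Q u \<union> prod.swap ` Q u))"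
    by (rule card_UN_le[OF finV])
  also have "\<dots> \<le> (\<Sum>u\<in>verts G. 2 * d * (card (N u) - 1))"
  proof (rule sum_mono)
    fix u assume u: "u \<in> verts G"
    have "card (Q u \<union> prod.swap ` Q u) \<le> card (Q u) + card (prod.swap ` Q u)"
      by (rule card_Un_le)
    also have "\<dots> \<le> card (Q u) + card (Q u)" using card_image_le[OF finQ] by simp
    finally show "card (Q u \<union> prod.swap ` Q u) \<le> 2 * d * (card (N u) - 1)"
      using card_Q[OF u] by simp
  qed
  also have "\<dots> = 2 * d * (\<Sum>u\<in>verts G. card (N u) - 1)" by (simp add: sum_distrib_left)
  also have "\<dots> \<le> 2 * d * (r * card X)"
    unfolding N_def by (intro mult_left_mono sum_excess_degree_le[OF G f X(1) color]) auto
  finally have le: "(\<Sum>w\<in>X. card {v \<in> X. conflict G A f w v}) \<le> (\<Sum>w\<in>X. 2 * d * r)"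
    using finX by (simp add: mult_ac)
  have "\<exists>w\<in>X. card {v \<in> X. conflict G A f w v} \<le> 2 * d * r"
  proof (rule ccontr)
    assume "\<not> ?thesis"
    then have "(\<Sum>w\<in>X. 2 * d * r) < (\<Sum>w\<in>X. card {v \<in> X. conflict G A f w v})"
      using finX X(2) by (intro sum_strict_mono) (auto simp: not_le)
    with le show False by simp
  qed
  moreover have "{v \<in> X. conflict G A f w v} = {v \<in> W. conflict G A f w v}" if "w \<in> X" for w
    using that by (auto simp: X_def conflict_def)
  ultimately show ?thesis by (auto simp: X_def)
qed

lemma separating_coloring_exists:
  assumes G: "simple_graph G" and f: "acyclic_coloring r G f" and A: "bounded_orientation d G A"
  shows "\<exists>g. g ` verts G \<subseteq> {..<r * (2 * d * r + 1)} \<and> separates_paths A g"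
proof -
  define m where "m = 2 * d * r"
  have "\<exists>h::'a \<Rightarrow> nat. h ` verts G \<subseteq> {..m} \<and>
      (\<forall>x\<in>verts G. \<forall>y\<in>verts G. x \<noteq> y \<longrightarrow> conflict G A f x y \<longrightarrow> h x \<noteq> h y)"
  proof (rule degenerate_coloring)
    show "finite (verts G)" using G by (simp add: simple_graph_def)
    show "conflict G A f y x" if "conflict G A f x y" for x y
      using that by (auto simp: conflict_def)
  qed (use conflict_degenerate[OF G f A] in \<open>auto simp: m_def\<close>)
  then obtain h :: "'a \<Rightarrow> nat" where h: "h ` verts G \<subseteq> {..m}"
    "\<And>x y. x \<in> verts G \<Longrightarrow> y \<in> verts G \<Longrightarrow> conflict G A f x y \<Longrightarrow> h x \<noteq> h y"
    by (auto simp: conflict_def)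
  define M where "M = m + 1"
  \<comment> \<open>The pair \<open>(f v, h v)\<close>, encoded as a single number in base \<open>M\<close>.\<close>
  define g where "g v = (f v - 1) * M + h v" for v
  have f_range: "1 \<le> f v \<and> f v \<le> r" if "v \<in> verts G" for v
    using f that by (auto simp: acyclic_coloring_def)
  have h_range: "h v < M" if "v \<in> verts G" for v
    using h(1) that by (fastforce simp: M_def)
  have "g v < r * M" if "v \<in> verts G" for v
  proof -
    have "g v < (f v - 1) * M + M" using h_range[OF that] by (simp add: g_def)
    also have "\<dots> = f v * M" using f_range[OF that] by (cases "f v") auto
    also have "\<dots> \<le> r * M" using f_range[OF that] by (intro mult_right_mono) auto
    finally show ?thesis .
  qed
  moreover have "separates_paths A g"
    unfolding separates_paths_def
  proof (intro allI impI notI)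
    fix w u v assume wv: "w \<noteq> v" and wu: "(w, u) \<in> A" and vu: "(v, u) \<in> A \<or> (u, v) \<in> A"
      and eq: "g w = g v"
    have ori: "orientation G A" using A by (simp add: bounded_orientation_def)
    have e: "{w, u} \<in> edges G" "{v, u} \<in> edges G"
      using wu vu orientation_iff[OF G, THEN iffD1, OF ori] insert_commute[of u v] by metis+
    then have vs: "w \<in> verts G" "v \<in> verts G" using edge_endpoints[OF G] by blast+
    have "h x = g x mod M" "f x - 1 = g x div M" if "x \<in> verts G" for x
      using h_range[OF that] by (simp_all add: g_def)
    with eq vs have "h w = h v" "f w - 1 = f v - 1" by metis+
    then have "f w = f v" using f_range[OF vs(1)] f_range[OF vs(2)] by linarith
    then have "conflict G A f w v" using wv wu e by (auto simp: conflict_def)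
    with h(2)[OF vs] \<open>h w = h v\<close> show False by simp
  qed
  ultimately show ?thesis unfolding M_def m_def by blast
qed

section \<open>The universal graph\<close>

text \<open>A target vertex \<open>(x, S, \<phi>)\<close> stands for a vertex with label \<open>x\<close> whose in-neighbours have labels
  in \<open>S\<close>, the arc from the in-neighbour with label \<open>y\<close> having color \<open>\<phi> y\<close>.\<close>
type_synonym target = "nat \<times> nat set \<times> (nat \<Rightarrow> nat)"

definition target_verts :: "nat \<Rightarrow> nat \<Rightarrow> nat \<Rightarrow> target set" where
  "target_verts N d k =
     (SIGMA x:{..<N}. SIGMA S:{S. S \<subseteq> {..<N} \<and> card S = d}. S \<rightarrow>\<^sub>E {1..k})"

text \<open>The second conjunct makes the relation asymmetric, so that an edge of the target has a
  definite direction and \<open>target_color\<close> is well defined.\<close>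
definition target_arc :: "target \<Rightarrow> target \<Rightarrow> bool" where
  "target_arc p q \<longleftrightarrow> fst p \<in> fst (snd q) \<and> fst q \<notin> fst (snd p)"

definition target_graph :: "nat \<Rightarrow> nat \<Rightarrow> nat \<Rightarrow> target ugraph" where
  "target_graph N d k =
     \<lparr>verts = target_verts N d k,
      edges = {{p, q} | p q. p \<in> target_verts N d k \<and> q \<in> target_verts N d k \<and> target_arc p q}\<rparr>"

definition target_color :: "target set \<Rightarrow> nat" where
  "target_color e = (THE c. \<exists>p q. e = {p, q} \<and> target_arc p q \<and> c = snd (snd q) (fst p))"

lemma target_arc_asym: "target_arc p q \<Longrightarrow> \<not> target_arc q p"
  by (simp add: target_arc_def)

lemma target_color_arc:
  assumes "target_arc p q"
  shows "target_color {p, q} = snd (snd q) (fst p)"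
  unfolding target_color_def
proof (rule the_equality)
  show "\<exists>p' q'. {p, q} = {p', q'} \<and> target_arc p' q' \<and> snd (snd q) (fst p) = snd (snd q') (fst p')"
    using assms by blast
  fix c assume "\<exists>p' q'. {p, q} = {p', q'} \<and> target_arc p' q' \<and> c = snd (snd q') (fst p')"
  then obtain p' q' where "{p, q} = {p', q'}" "target_arc p' q'" "c = snd (snd q') (fst p')" by blast
  moreover have "\<not> target_arc q p" using assms by (rule target_arc_asym)
  ultimately show "c = snd (snd q) (fst p)" by (metis doubleton_eq_iff)
qed

lemma finite_target_verts: "finite (target_verts N d k)"
  by (auto simp: target_verts_def intro!: finite_SigmaI finite_PiE intro: finite_subset)

lemma card_target_verts: "card (target_verts N d k) = N * (N choose d) * k ^ d"
proof -
  have fin: "finite {S. S \<subseteq> {..<N} \<and> card S = d}"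
    by (rule finite_subset[of _ "Pow {..<N}"]) auto
  have PiE: "finite (S \<rightarrow>\<^sub>E {1..k}) \<and> card (S \<rightarrow>\<^sub>E {1..k}) = k ^ d"
    if "S \<subseteq> {..<N} \<and> card S = d" for S
    using that finite_subset[of S "{..<N}"] by (auto simp: card_PiE finite_PiE)
  have "card (SIGMA S:{S. S \<subseteq> {..<N} \<and> card S = d}. S \<rightarrow>\<^sub>E {1..k})
      = (\<Sum>S | S \<subseteq> {..<N} \<and> card S = d. card (S \<rightarrow>\<^sub>E {1..k}))"
    using fin PiE by (intro card_SigmaI) auto
  also have "\<dots> = (\<Sum>S | S \<subseteq> {..<N} \<and> card S = d. k ^ d)"
    using PiE by (intro sum.cong) auto
  also have "\<dots> = (N choose d) * k ^ d" using n_subsets[of "{..<N}" d] by simp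
  finally show ?thesis
    by (simp add: target_verts_def card_cartesian_product)
qed

lemma target_edge_colored:
  assumes "target_verts N d k \<noteq> {}"
  shows "edge_colored_graph k (target_graph N d k) target_color"
proof -
  have "card {p, q} = 2" if "target_arc p q" for p q
    using that by (cases "p = q") (auto simp: target_arc_def)
  moreover have "target_color {p, q} \<in> {1..k}"
    if "q \<in> target_verts N d k" "target_arc p q" for p q
    using that target_color_arc[OF that(2)]
    by (auto simp: target_verts_def target_arc_def dest: PiE_mem)
  ultimately show ?thesis
    using assms finite_target_verts[of N d k]
    unfolding edge_colored_graph_def simple_graph_def target_graph_def
    by (simp only: ugraph.simps image_subset_iff) blast
qed

text \<open>The records are padded to \<open>d\<close> labels with labels from \<open>{M..<M + d}\<close>. No vertex has such a label,
  because \<open>g\<close> stays below \<open>M\<close>, so the padding does not affect which pairs form a \<open>target_arc\<close>.\<close>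
lemma hom_to_target:
  assumes G: "edge_colored_graph k G c" and A: "bounded_orientation d G A"
    and g: "g ` verts G \<subseteq> {..<M}" "separates_paths A g" and N: "M + d \<le> N" and "k \<ge> 1"
  shows "\<exists>h. colored_hom G c (target_graph N d k) target_color h"
proof -
  have simple: "simple_graph G" and c: "\<And>e. e \<in> edges G \<Longrightarrow> c e \<in> {1..k}"
    using G by (auto simp: edge_colored_graph_def)
  have ori: "orientation G A" and indeg: "\<And>b. b \<in> verts G \<Longrightarrow> indegree A b \<le> d"
    using A by (auto simp: bounded_orientation_def)
  note A_iff = orientation_iff[OF simple, THEN iffD1, OF ori]
  define I where "I v = {u. (u, v) \<in> A}" for v
  define S where "S v = g ` I v \<union> {M..<M + (d - card (I v))}" for v
  define \<phi> where "\<phi> v = (\<lambda>x\<in>S v. if x \<in> g ` I v then c {inv_into (I v) g x, v} else 1)" for v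
  define h where "h v = (g v, S v, \<phi> v)" for v
  have I_verts: "I v \<subseteq> verts G" for v
    unfolding I_def using A_iff edge_endpoints(1)[OF simple] by blast
  have finI: "finite (I v)" for v
    using finite_subset[OF I_verts] simple by (simp add: simple_graph_def)
  have inj: "inj_on g (I v)" for v
    using g(2) unfolding separates_paths_def inj_on_def I_def by blast
  have gI: "g ` I v \<subseteq> {..<M}" for v using g(1) I_verts by blast
  have h_in: "h v \<in> target_verts N d k" if v: "v \<in> verts G" for v
  proof -
    have "g v < N" using v g(1) N by fastforce
    moreover have "S v \<subseteq> {..<N}" using gI[of v] N by (fastforce simp: S_def)
    moreover have "card (S v) = card (g ` I v) + card {M..<M + (d - card (I v))}"
      unfolding S_def using finI gI[of v] by (intro card_Un_disjoint) auto
    then have "card (S v) = d"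
      using indeg[OF v] card_image[OF inj, of v] by (simp add: indegree_def I_def)
    moreover have "\<phi> v \<in> S v \<rightarrow>\<^sub>E {1..k}"
    proof -
      have "c {inv_into (I v) g x, v} \<in> {1..k}" if "x \<in> g ` I v" for x
      proof -
        have "inv_into (I v) g x \<in> I v" using that by (rule inv_into_into)
        then have "{inv_into (I v) g x, v} \<in> edges G" using A_iff by (simp add: I_def)
        then show ?thesis by (rule c)
      qed
      then show ?thesis using \<open>k \<ge> 1\<close> by (auto simp: \<phi>_def)
    qed
    ultimately show ?thesis by (simp add: target_verts_def h_def)
  qed
  have arc: "target_arc (h u) (h v) \<and> target_color {h u, h v} = c {u, v}" if uv: "(u, v) \<in> A" for u v
  proof -
    have u: "u \<in> I v" using uv by (simp add: I_def)
    then have gu: "g u \<in> g ` I v" "g u \<in> S v" by (auto simp: S_def)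
    have "v \<in> verts G" using uv A_iff edge_endpoints[OF simple] by blast
    then have "g v < M" using g(1) by auto
    \<comment> \<open>An in-neighbour \<open>w\<close> of \<open>u\<close> is separated from \<open>v\<close> by the path \<open>w \<rightarrow> u \<rightarrow> v\<close>.\<close>
    moreover have "g v \<notin> g ` I u"
    proof
      assume "g v \<in> g ` I u"
      then obtain w where w: "(w, u) \<in> A" "g w = g v" by (auto simp: I_def)
      moreover have "w \<noteq> v" using w uv A_iff by blast
      ultimately show False using g(2) uv unfolding separates_paths_def by blast
    qed
    ultimately have arc: "target_arc (h u) (h v)"
      using gu by (auto simp: target_arc_def h_def S_def)
    have "inv_into (I v) g (g u) = u" using inj u by (rule inv_into_f_f)
    then have "snd (snd (h v)) (fst (h u)) = c {u, v}" using gu by (simp add: h_def \<phi>_def)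
    with arc show ?thesis using target_color_arc[OF arc] by simp
  qed
  have "colored_hom G c (target_graph N d k) target_color h"
    unfolding colored_hom_def
  proof (intro conjI allI impI)
    show "h ` verts G \<subseteq> verts (target_graph N d k)" using h_in by (auto simp: target_graph_def)
    fix u v assume e: "{u, v} \<in> edges G"
    have *: "{h a, h b} \<in> edges (target_graph N d k) \<and> c {a, b} = target_color {h a, h b}"
      if "(a, b) \<in> A" for a b
    proof -
      have "a \<in> verts G" "b \<in> verts G" using that A_iff edge_endpoints[OF simple] by blast+
      then have "h a \<in> target_verts N d k" "h b \<in> target_verts N d k" by (auto intro: h_in)
      with arc[OF that] show ?thesis
        unfolding target_graph_def by (simp only: ugraph.simps) blast
    qed
    have "(u, v) \<in> A \<or> (v, u) \<in> A" using e A_iff by blast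
    then show "{h u, h v} \<in> edges (target_graph N d k)" "c {u, v} = target_color {h u, h v}"
      using *[of u v] *[of v u] by (auto simp: insert_commute)
  qed
  then show ?thesis by blast
qed

text \<open>\<open>universal_number\<close> ranges over graphs on natural numbers; \<open>H\<close> is transported there along an
  injection.\<close>
lemma universal_number_le_card:
  fixes H :: "'b ugraph"
  assumes "universal_graph k F H cH"
  shows "universal_number F k \<le> enat (card (verts H))"
proof -
  have H: "simple_graph H" and cH: "cH ` edges H \<subseteq> {1..k}"
    and univ: "\<And>G c. G \<in> F \<Longrightarrow> edge_colored_graph k G c \<Longrightarrow> \<exists>h. colored_hom G c H cH h"
    using assms by (auto simp: universal_graph_def edge_colored_graph_def)
  then have "finite (verts H)" by (simp add: simple_graph_def)
  then obtain \<iota> :: "'b \<Rightarrow> nat" where inj: "inj_on \<iota> (verts H)"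
    by (metis finite_imp_inj_to_nat_seg)
  have sub: "e \<subseteq> verts H" if "e \<in> edges H" for e
    using that H by (simp add: simple_graph_def)
  define K where "K = \<lparr>verts = \<iota> ` verts H, edges = (`) \<iota> ` edges H\<rparr>"
  define cK where "cK e = cH (inv_into (verts H) \<iota> ` e)" for e
  have cK: "cK (\<iota> ` e) = cH e" if "e \<in> edges H" for e
    using inv_into_image_cancel[OF inj sub[OF that]] by (simp add: cK_def)
  have card_e: "card (\<iota> ` e) = card e" if "e \<in> edges H" for e
    using inj_on_subset[OF inj sub[OF that]] by (rule card_image)
  have "universal_graph k F K cK"
    unfolding universal_graph_def
  proof (intro conjI ballI allI impI)
    show "edge_colored_graph k K cK"
      using H sub cK card_e cH by (auto simp: edge_colored_graph_def simple_graph_def K_def)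
    fix G :: "'a ugraph" and c assume "G \<in> F" "edge_colored_graph k G c"
    then obtain h where h: "colored_hom G c H cH h" using univ by blast
    have "colored_hom G c K cK (\<iota> \<circ> h)"
      unfolding colored_hom_def
    proof (intro conjI allI impI)
      show "(\<iota> \<circ> h) ` verts G \<subseteq> verts K" using h by (auto simp: colored_hom_def K_def)
      fix u v assume "{u, v} \<in> edges G"
      then have e: "{h u, h v} \<in> edges H" "c {u, v} = cH {h u, h v}"
        using h by (auto simp: colored_hom_def)
      have "{(\<iota> \<circ> h) u, (\<iota> \<circ> h) v} = \<iota> ` {h u, h v}" by simp
      then show "{(\<iota> \<circ> h) u, (\<iota> \<circ> h) v} \<in> edges K"
        using e(1) unfolding K_def ugraph.simps by (rule image_eqI)
      show "c {u, v} = cK {(\<iota> \<circ> h) u, (\<iota> \<circ> h) v}" using e cK[OF e(1)] by simp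
    qed
    then show "\<exists>h. colored_hom G c K cK h" by blast
  qed
  moreover have "card (verts K) = card (verts H)"
    using card_image[OF inj] by (simp add: K_def)
  ultimately show ?thesis
    unfolding universal_number_def by (intro Inf_lower) (auto intro!: exI[of _ K] exI[of _ cK])
qed

text \<open>The case \<open>d = 0\<close> is included, since the density of a class of edgeless graphs is zero.\<close>
lemma universal_number_le:
  assumes F: "graph_class F" and "r > 0"
    and acyclic: "\<And>G. G \<in> F \<Longrightarrow> \<exists>f. acyclic_coloring r G f"
    and orient: "\<And>G. G \<in> F \<Longrightarrow> \<exists>A. bounded_orientation d G A"
    and N: "r * (2 * d * r + 1) + d \<le> N" and "k \<ge> 1"
  shows "universal_number F k \<le> enat (N * (N choose d) * k ^ d)"
proof -
  have "N > 0" "N choose d > 0" using N \<open>r > 0\<close> by (auto intro: Nat.gr0I)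
  then have "card (target_verts N d k) \<noteq> 0" using \<open>k \<ge> 1\<close> by (simp add: card_target_verts)
  then have nonempty: "target_verts N d k \<noteq> {}" by force
  have "universal_graph k F (target_graph N d k) target_color"
    unfolding universal_graph_def
  proof (intro conjI ballI allI impI)
    show "edge_colored_graph k (target_graph N d k) target_color"
      by (rule target_edge_colored[OF nonempty])
    fix G c assume G: "G \<in> F" and c: "edge_colored_graph k G c"
    obtain f A where f: "acyclic_coloring r G f" and A: "bounded_orientation d G A"
      using acyclic[OF G] orient[OF G] by blast
    have "simple_graph G" using F G by (simp add: graph_class_def)
    from separating_coloring_exists[OF this f A] obtain g where
      "g ` verts G \<subseteq> {..<r * (2 * d * r + 1)}" "separates_paths A g" by blast
    then show "\<exists>h. colored_hom G c (target_graph N d k) target_color h"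
      using hom_to_target[OF c A _ _ N \<open>k \<ge> 1\<close>] by blast
  qed
  from universal_number_le_card[OF this] show ?thesis
    by (simp add: target_graph_def card_target_verts)
qed

section \<open>Orientations of sparse graphs\<close>

lemma indegree_reverse_arc:
  assumes "simple_graph G" "orientation G A" "(u, w) \<in> A"
  defines "B \<equiv> insert (w, u) (A - {(u, w)})"
  shows "orientation G B"
    and "indegree B x + of_bool (x = w) = indegree A x + of_bool (x = u)"
proof -
  note A = orientation_iff[OF assms(1), THEN iffD1, OF assms(2)]
  show "orientation G B"
    unfolding orientation_iff[OF assms(1)] B_def
    using A assms(3) edge_endpoints(3)[OF assms(1)] by (auto simp: insert_commute)
  have wu: "(w, u) \<notin> A" and "u \<noteq> w"
    using A assms(3) by auto
  note fin = finite_in_neighbours[OF orientation_finite[OF assms(1,2)]]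
  have "{a. (a, w) \<in> B} = {a. (a, w) \<in> A} - {u}" "{a. (a, u) \<in> B} = insert w {a. (a, u) \<in> A}"
    using \<open>u \<noteq> w\<close> by (auto simp: B_def)
  moreover have "{a. (a, x) \<in> B} = {a. (a, x) \<in> A}" if "x \<noteq> u" "x \<noteq> w"
    using that by (auto simp: B_def)
  ultimately show "indegree B x + of_bool (x = w) = indegree A x + of_bool (x = u)"
    using \<open>u \<noteq> w\<close> wu fin assms(3) card_Suc_Diff1[of "{a. (a, w) \<in> A}" u]
    by (auto simp: indegree_def)
qed

text \<open>The step after the last visit to \<open>u\<close>.\<close>
lemma rtrancl_first_step_leaving:
  assumes "(u, v) \<in> R\<^sup>*" "u \<noteq> v"
  shows "\<exists>w. (u, w) \<in> R \<and> (w, v) \<in> {(a, b) \<in> R. a \<noteq> u \<and> b \<noteq> u}\<^sup>*"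
proof -
  define R' where "R' = {(a, b) \<in> R. a \<noteq> u \<and> b \<noteq> u}"
  have "v = u \<or> (\<exists>w. (u, w) \<in> R \<and> (w, v) \<in> R'\<^sup>*)"
    using assms(1)
  proof (induction rule: rtrancl_induct)
    case base
    show ?case by simp
  next
    case (step y z)
    consider "z = u" | "z \<noteq> u" "y = u" | "z \<noteq> u" "y \<noteq> u" by blast
    then show ?case
    proof cases
      case 1
      then show ?thesis by simp
    next
      case 2
      then show ?thesis using step.hyps by auto
    next
      case 3
      then have "(y, z) \<in> R'" using step.hyps by (simp add: R'_def)
      with 3 step.IH show ?thesis by (meson rtrancl.rtrancl_into_rtrancl)
    qed
  qed
  with assms(2) show ?thesis by (simp add: R'_def)
qed

text \<open>Reversing a path from \<open>u\<close> to \<open>v\<close> moves one unit of in-degree from \<open>v\<close> to \<open>u\<close>; the equation is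
  stated with additions on both sides to cover \<open>u = v\<close> and to avoid truncated subtraction. The
  induction on \<open>S\<close> reverses the first arc and continues in \<open>S - {u}\<close>, where no arc has changed.\<close>
lemma indegree_reverse_path:
  assumes "simple_graph G" "finite S" "orientation G A" "(u, v) \<in> {(a, b) \<in> A. a \<in> S \<and> b \<in> S}\<^sup>*"
  shows "\<exists>B. orientation G B \<and>
    (\<forall>x. indegree B x + of_bool (x = v) = indegree A x + of_bool (x = u))"
  using assms(2-)
proof (induction "card S" arbitrary: S A u)
  case 0
  then have "u = v" by auto
  then show ?case using 0 by auto
next
  case (Suc n)
  show ?case
  proof (cases "u = v")
    case True
    then show ?thesis using Suc.prems by auto
  next
    case False
    then obtain w where uw: "(u, w) \<in> {(a, b) \<in> A. a \<in> S \<and> b \<in> S}"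
      and wv: "(w, v) \<in> {(a, b) \<in> {(a, b) \<in> A. a \<in> S \<and> b \<in> S}. a \<noteq> u \<and> b \<noteq> u}\<^sup>*"
      using rtrancl_first_step_leaving[OF Suc.prems(3)] by blast
    define A' where "A' = insert (w, u) (A - {(u, w)})"
    have uwA: "(u, w) \<in> A" using uw by auto
    note A' = indegree_reverse_arc[OF assms(1) Suc.prems(2) uwA, folded A'_def]
    have "{(a, b) \<in> {(a, b) \<in> A. a \<in> S \<and> b \<in> S}. a \<noteq> u \<and> b \<noteq> u}
        = {(a, b) \<in> A'. a \<in> S - {u} \<and> b \<in> S - {u}}"
      by (auto simp: A'_def)
    then have wv': "(w, v) \<in> {(a, b) \<in> A'. a \<in> S - {u} \<and> b \<in> S - {u}}\<^sup>*" using wv by simp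
    have "n = card (S - {u})" using Suc.hyps(2) Suc.prems(1) uw by simp
    from Suc.hyps(1)[OF this _ A'(1) wv'] Suc.prems(1)
    obtain B where B: "orientation G B"
      "\<And>x. indegree B x + of_bool (x = v) = indegree A' x + of_bool (x = w)"
      by auto
    then have "\<forall>x. indegree B x + of_bool (x = v) = indegree A x + of_bool (x = u)"
      using A'(2) by simp
    with B show ?thesis by blast
  qed
qed

text \<open>Take an orientation with least total excess of the in-degrees over \<open>m\<close>, and suppose that \<open>v\<close> has
  in-degree above \<open>m\<close>. No arc enters the set \<open>R\<close> of vertices from which \<open>v\<close> can be reached, so the
  in-degrees in \<open>R\<close> sum to the number of edges inside \<open>R\<close>. By sparsity, some \<open>u \<in> R\<close> has in-degree
  below \<open>m\<close>, and reversing a path from \<open>u\<close> to \<open>v\<close> lowers the excess.\<close>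
lemma bounded_orientation_if_sparse:
  assumes G: "simple_graph G"
    and sparse: "\<And>X. X \<subseteq> verts G \<Longrightarrow> X \<noteq> {} \<Longrightarrow> card {e \<in> edges G. e \<subseteq> X} \<le> m * card X"
  shows "\<exists>A. bounded_orientation m G A"
proof -
  define excess where "excess A = (\<Sum>v\<in>verts G. indegree A v - m)" for A
  have finV: "finite (verts G)" using G by (simp add: simple_graph_def)
  obtain A0 where "orientation G A0" using orientation_exists[OF G] .
  then obtain A where A: "orientation G A"
    and least: "\<And>B. orientation G B \<Longrightarrow> excess A \<le> excess B"
    using ex_has_least_nat[of "orientation G" A0 excess] by blast
  note A_iff = orientation_iff[OF G, THEN iffD1, OF A]
  have finA: "finite A" by (rule orientation_finite[OF G A])
  have verts: "a \<in> verts G" "b \<in> verts G" if "(a, b) \<in> A" for a b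
    using that A_iff edge_endpoints[OF G] by blast+
  have "indegree A v \<le> m" if v: "v \<in> verts G" for v
  proof (rule ccontr)
    assume v_gt: "\<not> indegree A v \<le> m"
    define R where "R = {u. (u, v) \<in> A\<^sup>*}"
    have R_sub: "R \<subseteq> verts G"
      using v verts by (auto simp: R_def elim: converse_rtranclE)
    have "v \<in> R" by (simp add: R_def)
    have closed: "a \<in> R" if "(a, b) \<in> A" "b \<in> R" for a b
      using that by (auto simp: R_def intro: converse_rtrancl_into_rtrancl)
    have finR: "finite R" using R_sub finV finite_subset by blast
    have "(\<Sum>b\<in>R. indegree A b) = card {(a, b) \<in> A. b \<in> R}"
      using card_arcs_into[OF finA finR] ..
    also have "\<dots> \<le> card {e \<in> edges G. e \<subseteq> R}"
    proof (rule card_inj_on_le)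
      show "inj_on (\<lambda>(a, b). {a, b}) {(a, b) \<in> A. b \<in> R}"
        using A by (auto simp: orientation_def bij_betw_def intro: inj_on_subset)
      show "(\<lambda>(a, b). {a, b}) ` {(a, b) \<in> A. b \<in> R} \<subseteq> {e \<in> edges G. e \<subseteq> R}"
        using closed A_iff by auto
      show "finite {e \<in> edges G. e \<subseteq> R}" using simple_graph_finite_edges[OF G] by simp
    qed
    also have "\<dots> \<le> m * card R" using sparse[OF R_sub] \<open>v \<in> R\<close> by blast
    finally have le: "(\<Sum>b\<in>R. indegree A b) \<le> (\<Sum>b\<in>R. m)" by (simp add: mult.commute)
    have "\<exists>u\<in>R. indegree A u < m"
    proof (rule ccontr)
      assume "\<not> ?thesis"
      then have "(\<Sum>b\<in>R. m) < (\<Sum>b\<in>R. indegree A b)"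
        using v_gt \<open>v \<in> R\<close> finR by (intro sum_strict_mono_ex1) (auto simp: not_less intro!: bexI[of _ v])
      with le show False by simp
    qed
    then obtain u where u: "u \<in> R" "indegree A u < m" by blast
    have "{(a, b) \<in> A. a \<in> verts G \<and> b \<in> verts G} = A" using verts by auto
    with u have "(u, v) \<in> {(a, b) \<in> A. a \<in> verts G \<and> b \<in> verts G}\<^sup>*" by (simp add: R_def)
    from indegree_reverse_path[OF G finV A this]
    obtain B where B: "orientation G B"
      and deg: "\<And>x. indegree B x + of_bool (x = v) = indegree A x + of_bool (x = u)" by blast
    have "u \<noteq> v" using u v_gt by auto
    have "excess B < excess A"
      unfolding excess_def
    proof (rule sum_strict_mono_ex1[OF finV])
      show "\<forall>x\<in>verts G. indegree B x - m \<le> indegree A x - m"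
      proof
        fix x
        show "indegree B x - m \<le> indegree A x - m"
          using deg[of x] u by (cases "x = u"; cases "x = v") auto
      qed
      show "\<exists>x\<in>verts G. indegree B x - m < indegree A x - m"
        using deg[of v] v v_gt \<open>u \<noteq> v\<close> by (intro bexI[of _ v]) auto
    qed
    with least[OF B] show False by simp
  qed
  with A show ?thesis unfolding bounded_orientation_def by blast
qed

section \<open>Density\<close>

lemma finite_subgraph_ratios:
  assumes "simple_graph G"
  shows "finite {real (card (edges H)) / real (card (verts H)) | H. subgraph H G}"
proof (rule finite_subset)
  show "finite ((\<lambda>(V, E). real (card E) / real (card V)) ` (Pow (verts G) \<times> Pow (edges G)))"
    using assms simple_graph_finite_edges[OF assms] by (simp add: simple_graph_def)
qed (auto simp: subgraph_def)

lemma subgraph_ratio_le_density: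
  assumes "simple_graph G" "subgraph H G"
  shows "real (card (edges H)) / real (card (verts H)) \<le> density G"
  unfolding density_def using assms by (intro Max_ge finite_subgraph_ratios) auto

lemma subgraph_refl: "simple_graph G \<Longrightarrow> subgraph G G"
  by (simp add: subgraph_def)

lemma density_nonneg:
  assumes "simple_graph G"
  shows "0 \<le> density G"
  using subgraph_ratio_le_density[OF assms subgraph_refl[OF assms]]
  by (rule order_trans[rotated]) simp

lemma card_induced_edges_le_density:
  assumes G: "simple_graph G" and X: "X \<subseteq> verts G" "X \<noteq> {}"
  shows "real (card {e \<in> edges G. e \<subseteq> X}) \<le> density G * real (card X)"
proof -
  have "finite X" using X(1) G by (auto simp: simple_graph_def intro: finite_subset)
  then have "subgraph \<lparr>verts = X, edges = {e \<in> edges G. e \<subseteq> X}\<rparr> G"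
    using G X by (auto simp: subgraph_def simple_graph_def)
  from subgraph_ratio_le_density[OF G this] show ?thesis
    using \<open>finite X\<close> X(2) by (simp add: divide_le_eq card_gt_0_iff)
qed

text \<open>Every edge of a subgraph is counted by the in-degree of its head, which lies in the subgraph.\<close>
lemma density_le_if_bounded_orientation:
  assumes G: "simple_graph G" and A: "bounded_orientation d G A"
  shows "density G \<le> real d"
proof -
  have ori: "orientation G A" and indeg: "\<And>b. b \<in> verts G \<Longrightarrow> indegree A b \<le> d"
    using A by (auto simp: bounded_orientation_def)
  note finA = orientation_finite[OF G ori]
  have "real (card (edges H)) / real (card (verts H)) \<le> real d" if H: "subgraph H G" for H
  proof -
    have H': "simple_graph H" "verts H \<subseteq> verts G" "edges H \<subseteq> edges G"
      using H by (auto simp: subgraph_def)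
    then have fin: "finite (verts H)" "verts H \<noteq> {}" by (auto simp: simple_graph_def)
    have "edges H \<subseteq> (\<lambda>(a, b). {a, b}) ` {(a, b) \<in> A. b \<in> verts H}"
    proof
      fix e assume e: "e \<in> edges H"
      then have "e \<in> (\<lambda>(a, b). {a, b}) ` A"
        using H'(3) ori by (auto simp: orientation_def bij_betw_def)
      then obtain a b where "(a, b) \<in> A" "e = {a, b}" by auto
      moreover have "e \<subseteq> verts H" using H'(1) e by (simp add: simple_graph_def)
      ultimately show "e \<in> (\<lambda>(a, b). {a, b}) ` {(a, b) \<in> A. b \<in> verts H}" by force
    qed
    moreover have finB: "finite {(a, b) \<in> A. b \<in> verts H}"
      using finA by (rule rev_finite_subset) auto
    ultimately have "card (edges H) \<le> card {(a, b) \<in> A. b \<in> verts H}"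
      using surj_card_le by blast
    also have "\<dots> = (\<Sum>b\<in>verts H. indegree A b)" by (rule card_arcs_into[OF finA fin(1)])
    also have "\<dots> \<le> (\<Sum>b\<in>verts H. d)" using indeg H'(2) by (intro sum_mono) auto
    finally have "real (card (edges H)) \<le> real d * real (card (verts H))"
      by (simp add: mult.commute flip: of_nat_mult)
    then show ?thesis using fin by (simp add: divide_le_eq card_gt_0_iff)
  qed
  then show ?thesis
    unfolding density_def using subgraph_refl[OF G]
    by (subst Max_le_iff) (auto intro: finite_subgraph_ratios[OF G])
qed

lemma bounded_orientation_if_density_le:
  assumes G: "simple_graph G" and "density G \<le> real m"
  shows "\<exists>A. bounded_orientation m G A"
proof (rule bounded_orientation_if_sparse[OF G])
  fix X assume X: "X \<subseteq> verts G" "X \<noteq> {}"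
  have "real (card {e \<in> edges G. e \<subseteq> X}) \<le> density G * real (card X)"
    by (rule card_induced_edges_le_density[OF G X])
  also have "\<dots> \<le> real m * real (card X)" using assms(2) by (intro mult_right_mono) auto
  finally show "card {e \<in> edges G. e \<subseteq> X} \<le> m * card X"
    by (simp flip: of_nat_mult)
qed

theorem theorem5:
  fixes F :: "'a ugraph set" and r d :: nat
  assumes "graph_class F"
    and "r > 0" and "d > 0"
    and "\<And>G. G \<in> F \<Longrightarrow> \<exists>f. acyclic_coloring r G f"
    and "\<And>G. G \<in> F \<Longrightarrow> \<exists>A. bounded_orientation d G A"
  shows "(\<forall>k\<ge>2. universal_number F k
            \<le> enat (8 * d * r ^ 4 * ((8 * d * r ^ 4) choose d) * k ^ d)) \<and>
         (\<exists>D::real. class_density F = ereal D \<and>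
            (\<exists>(n\<^sub>0::nat) (C::real). \<forall>k\<ge>n\<^sub>0.
               ereal_of_enat (universal_number F k) \<le> ereal (C * real k ^ nat \<lceil>D\<rceil>)))"
proof
  have simple: "simple_graph G" if "G \<in> F" for G
    using that assms(1) by (simp add: graph_class_def)
  have "r * (2 * d * r + 1) + d \<le> 8 * d * r ^ 4"
  proof -
    have "d * r ^ 2 \<le> d * r ^ 4" using \<open>r > 0\<close> by (intro mult_left_mono power_increasing) auto
    moreover have "r \<le> d * r ^ 4"
      using mult_mono[of 1 d "r ^ 1" "r ^ 4"] \<open>r > 0\<close> \<open>d > 0\<close> power_increasing[of 1 4 r] by simp
    moreover have "d \<le> d * r ^ 4" using \<open>r > 0\<close> by simp
    moreover have "r * (2 * d * r + 1) + d = 2 * (d * r ^ 2) + r + d"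
      by (simp add: algebra_simps power2_eq_square)
    ultimately show ?thesis by linarith
  qed
  then show "\<forall>k\<ge>2. universal_number F k
      \<le> enat (8 * d * r ^ 4 * ((8 * d * r ^ 4) choose d) * k ^ d)"
    using universal_number_le[OF assms(1,2,4,5)] by simp
  obtain G0 where "G0 \<in> F" using assms(1) by (auto simp: graph_class_def)
  then have "0 \<le> ereal (density G0)" "ereal (density G0) \<le> class_density F"
    using density_nonneg[OF simple] by (auto simp: class_density_def intro: SUP_upper)
  then have "0 \<le> class_density F" by (rule order_trans)
  moreover have "class_density F \<le> ereal (real d)"
    unfolding class_density_def
    using assms(5) density_le_if_bounded_orientation[OF simple] by (intro SUP_least) force
  ultimately obtain D where D: "class_density F = ereal D"
    by (cases "class_density F") auto
  define m where "m = nat \<lceil>D\<rceil>"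
  define N where "N = r * (2 * m * r + 1) + m"
  have orient: "\<exists>A. bounded_orientation m G A" if "G \<in> F" for G
  proof (rule bounded_orientation_if_density_le[OF simple[OF that]])
    have "ereal (density G) \<le> ereal D" using that D by (metis SUP_upper class_density_def)
    then have "density G \<le> D" by simp
    also have "D \<le> real m" unfolding m_def by linarith
    finally show "density G \<le> real m" .
  qed
  have "ereal_of_enat (universal_number F k) \<le> ereal (real (N * (N choose m)) * real k ^ m)"
    if "k \<ge> 1" for k
  proof -
    have "ereal_of_enat (universal_number F k) \<le> ereal_of_enat (enat (N * (N choose m) * k ^ m))"
      using universal_number_le[OF assms(1,2,4) orient] that by (simp only: ereal_of_enat_le_iff N_def)
    then show ?thesis by simp
  qed
  with D show "\<exists>D::real. class_density F = ereal D \<and>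
      (\<exists>(n\<^sub>0::nat) (C::real). \<forall>k\<ge>n\<^sub>0.
         ereal_of_enat (universal_number F k) \<le> ereal (C * real k ^ nat \<lceil>D\<rceil>))"
    unfolding m_def by blast
qed

end
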